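(* Let $5 \le p \le q$ and let $D$ be a strong orientation of $K(3,p,q)$ with diameter two, with parts $V_1=\{x_1,x_2,x_3\}$, $V_2$ ($|V_2|=p$), $V_3$ ($|V_3|=q$). If exactly five of the eight sets $V_2^A$ ($A \subseteq \{1,2,3\}$) are nonempty, then $$q \le \binom{p-3}{\lfloor \frac{p-3}{2} \rfloor} + \binom{p-2}{\lfloor \frac{p-2}{2} \rfloor}.$$
   Context: $K(3,p,q)$ is the complete tripartite graph with parts $V_1=\{x_1,x_2,x_3\}$, $V_2$ of size $p$, $V_3$ of size $q$. A strong orientation is an orientation of all edges making the digraph strongly connected; its diameter is the maximum directed distance between ordered pairs of vertices. Write $u\to v$ if the edge $uv$ is oriented from $u$ to $v$. For $A \subseteq [3]=\{1,2,3\}$, let $N_D^A$ be the set of vertices $w$ such that $x_i \to w$ for all $i \in A$ and $w \to x_j$ for all $j \in [3]\setminus A$, and $V_2^A = V_2 \cap N_D^A$. The eight sets $V_2^A$ partition $V_2$. *)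

theory Defs
  imports
    "Graph_Theory.Pair_Digraph"
    "Graph_Theory.Digraph_Component"
    "Graph_Theory.Shortest_Path"
begin

text \<open>Undirected graphs are symmetric digraphs, as in \<^theory>\<open>Graph_Theory.Digraph\<close>.
  The parts are meant to be pairwise disjoint.\<close>

definition complete_tripartite :: "'a set \<Rightarrow> 'a set \<Rightarrow> 'a set \<Rightarrow> 'a pair_pre_digraph" where
  "complete_tripartite V1 V2 V3 =
    \<lparr> pverts = V1 \<union> V2 \<union> V3,
      parcs = V1 \<times> (V2 \<union> V3) \<union> V2 \<times> (V1 \<union> V3) \<union> V3 \<times> (V1 \<union> V2) \<rparr>"

definition orientation :: "'a pair_pre_digraph \<Rightarrow> 'a pair_pre_digraph \<Rightarrow> bool" where
  "orientation D G \<longleftrightarrow>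
    pverts D = pverts G \<and> parcs D \<subseteq> parcs G \<and>
    (\<forall>(u, v) \<in> parcs G. (u, v) \<in> parcs D \<longleftrightarrow> (v, u) \<notin> parcs D)"

definition strong_orientation :: "'a pair_pre_digraph \<Rightarrow> 'a pair_pre_digraph \<Rightarrow> bool" where
  "strong_orientation D G \<longleftrightarrow> orientation D G \<and> strongly_connected (with_proj D)"

text \<open>With unit weights \<^term>\<open>wf_digraph.\<mu>\<close> is the length of a shortest directed walk
  (infinite if there is none). For a finite nonempty digraph the supremum is a maximum.\<close>

definition distance :: "('a, 'b) pre_digraph \<Rightarrow> 'a \<Rightarrow> 'a \<Rightarrow> ereal" where
  "distance D u v = wf_digraph.\<mu> D (\<lambda>_. 1) u v"

definition diam :: "('a, 'b) pre_digraph \<Rightarrow> ereal" where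
  "diam D = (SUP (u, v) \<in> verts D \<times> verts D. distance D u v)"

text \<open>\<open>nbr_class D x A\<close> is \<open>N_D^A\<close>; the vertices of the first part are \<open>x 1\<close>, \<open>x 2\<close>, \<open>x 3\<close>.\<close>

definition nbr_class :: "'a pair_pre_digraph \<Rightarrow> (nat \<Rightarrow> 'a) \<Rightarrow> nat set \<Rightarrow> 'a set" where
  "nbr_class D x A =
    {w \<in> pverts D. (\<forall>i\<in>A. (x i, w) \<in> parcs D) \<and> (\<forall>j\<in>{1..3} - A. (w, x j) \<in> parcs D)}"

end

theory Submission
  imports Defs
begin

text \<open>
  Give every vertex \<open>w\<close> outside \<open>V1\<close> the type \<open>{i. x i \<rightarrow> w}\<close>. If \<open>u \<rightarrow> v\<close> is an arc between
  \<open>V2\<close> and \<open>V3\<close>, the return path of length two passes through \<open>V1\<close>, which forces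
  the type of \<open>u\<close> not to be contained in that of \<open>v\<close>. Hence no type occurs in both \<open>V2\<close> and \<open>V3\<close>,
  and a vertex of \<open>V3\<close> of type \<open>B\<close> has a free choice of arcs only towards the vertices of
  \<open>V2\<close> whose type is incomparable to \<open>B\<close>. By Sperner's theorem there are at most
  \<open>n choose (n div 2)\<close> vertices of type \<open>B\<close>, where \<open>n\<close> is the number of those vertices of \<open>V2\<close>; and
  \<open>n \<le> p - c\<close> if \<open>c\<close> of the five types in \<open>V2\<close> are comparable to \<open>B\<close>. Return paths between \<open>V1\<close>
  and \<open>V2\<close> show moreover that no \<open>i\<close> lies in all types of \<open>V3\<close> or in none. For each
  of the 56 choices of five types these constraints give the bound.
\<close>

section \<open>Sperner's theorem and central binomial coefficients\<close>

abbreviation (input) central_binomial :: "nat \<Rightarrow> nat" where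
  "central_binomial n \<equiv> n choose (n div 2)"

text \<open>Induction by deleting a point: the members of \<open>F\<close> avoiding \<open>x\<close>
  form an antichain in \<open>S - {x}\<close>. Summed over \<open>x\<close>, a member with
  \<open>k\<close> elements is counted \<open>n + 1 - k\<close> times with weight
  \<open>1 / (n choose k)\<close>, which is \<open>n + 1\<close> times its weight in
  \<open>S\<close>. The set \<open>S\<close> avoids no point, so \<open>S \<in> F\<close> is a
  separate case, where \<open>F = {S}\<close>.\<close>

lemma lubell_yamamoto_meshalkin:
  assumes "finite S" and "F \<subseteq> Pow S"
    and "\<And>A B. A \<in> F \<Longrightarrow> B \<in> F \<Longrightarrow> A \<subseteq> B \<Longrightarrow> A = B"
  shows "(\<Sum>A\<in>F. 1 / real (card S choose card A)) \<le> 1"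
  using assms
proof (induction "card S" arbitrary: S F)
  case 0
  then have "F \<subseteq> {{}}" by simp
  then consider "F = {}" | "F = {{}}" by blast
  then show ?case by cases auto
next
  case (Suc n)
  have fin: "finite F" using Suc.prems by (meson finite_Pow_iff finite_subset)
  show ?case
  proof (cases "S \<in> F")
    case True
    then have "F = {S}" using Suc.prems by blast
    then show ?thesis by simp
  next
    case False
    have small: "finite A \<and> card A \<le> n" if "A \<in> F" for A
    proof -
      have "A \<subset> S" using that Suc.prems(2) False by blast
      then show ?thesis using Suc.prems(1) Suc.hyps(2)
        by (metis finite_subset less_Suc_eq_le psubset_card_mono psubset_imp_subset)
    qed
    have "(\<Sum>x\<in>S. \<Sum>A | A \<in> F \<and> x \<notin> A. 1 / real (n choose card A)) \<le> (\<Sum>x\<in>S. 1)"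
    proof (rule sum_mono)
      fix x assume x: "x \<in> S"
      have n: "n = card (S - {x})" using x Suc.hyps(2) Suc.prems(1) by simp
      show "(\<Sum>A | A \<in> F \<and> x \<notin> A. 1 / real (n choose card A)) \<le> 1"
        using Suc.hyps(1)[OF n, of "{A \<in> F. x \<notin> A}"] Suc.prems n by auto
    qed
    also have "\<dots> = real (Suc n)" using Suc.hyps(2) by simp
    finally have "(\<Sum>A\<in>F. \<Sum>x | x \<in> S \<and> x \<notin> A. 1 / real (n choose card A)) \<le> real (Suc n)"
      using sum.swap_restrict[OF Suc.prems(1) fin, of "\<lambda>x A. 1 / real (n choose card A)"
        "\<lambda>x A. x \<notin> A"] by simp
    moreover have "(\<Sum>x | x \<in> S \<and> x \<notin> A. 1 / real (n choose card A))
        = real (Suc n) * (1 / real (card S choose card A))" if "A \<in> F" for A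
    proof -
      have "{x. x \<in> S \<and> x \<notin> A} = S - A" by blast
      moreover have "card (S - A) = Suc n - card A"
        using that small Suc.prems(2) Suc.hyps(2) by (metis PowD card_Diff_subset subset_eq)
      moreover have "real (Suc n - card A) * real (Suc n choose card A)
          = real (Suc n) * real (n choose card A)"
        using binomial_absorb_comp[of "Suc n" "card A"] by (metis diff_Suc_1 of_nat_mult)
      moreover have "n choose card A > 0" "Suc n choose card A > 0"
        using small[OF that] by simp_all
      ultimately show ?thesis using Suc.hyps(2)[symmetric] by (simp add: field_simps)
    qed
    ultimately have "real (Suc n) * (\<Sum>A\<in>F. 1 / real (card S choose card A)) \<le> real (Suc n)"
      by (simp add: sum_distrib_left)
    then show ?thesis by (simp del: of_nat_Suc)
  qed
qed

text \<open>The preceding inequality with every denominator replaced by the largest binomial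
  coefficient.\<close>

lemma sperner:
  assumes "finite S" and "F \<subseteq> Pow S"
    and "\<And>A B. A \<in> F \<Longrightarrow> B \<in> F \<Longrightarrow> A \<subseteq> B \<Longrightarrow> A = B"
  shows "card F \<le> central_binomial (card S)"
proof -
  have pos: "central_binomial (card S) > 0" by simp
  have "real (card F) / real (central_binomial (card S))
      = (\<Sum>A\<in>F. 1 / real (central_binomial (card S)))" by simp
  also have "\<dots> \<le> (\<Sum>A\<in>F. 1 / real (card S choose card A))"
  proof (rule sum_mono)
    fix A assume "A \<in> F"
    then have "card S choose card A > 0"
      using assms by (auto intro: card_mono)
    then show "1 / real (central_binomial (card S)) \<le> 1 / real (card S choose card A)"
      using binomial_maximum[of "card S" "card A"] by (intro divide_left_mono) auto
  qed
  also have "\<dots> \<le> 1" using lubell_yamamoto_meshalkin[OF assms] .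
  finally show ?thesis using pos by (simp add: divide_le_eq)
qed

text \<open>Pascal's rule, applied at the middle of row \<open>n + 2\<close>; one of its two terms
  is \<open>central_binomial (n + 1)\<close>, the other is at least
  \<open>central_binomial n\<close>.\<close>

lemma central_binomial_rec:
  "central_binomial (n + 1) + central_binomial n \<le> central_binomial (n + 2)"
proof (cases "even n")
  case True
  then obtain k where k: "n = 2 * k" by blast
  have "central_binomial (n + 2) = ((n + 1) choose k) + ((n + 1) choose (k + 1))"
    by (simp add: k)
  moreover have "(n + 1) choose (k + 1) = (n choose k) + (n choose (k + 1))" by simp
  ultimately show ?thesis by (simp add: k)
next
  case False
  then obtain k where k: "n = 2 * k + 1" using oddE by blast
  have "central_binomial (n + 2) = ((n + 1) choose k) + ((n + 1) choose (k + 1))"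
    by (simp add: k)
  moreover have "((n + 1) choose k) \<ge> (n choose k)" by (cases k) simp_all
  ultimately show ?thesis by (simp add: k)
qed

lemma central_binomial_mono:
  assumes "m \<le> n" shows "central_binomial m \<le> central_binomial n"
proof (rule lift_Suc_mono_le[OF _ assms])
  fix n :: nat
  show "central_binomial n \<le> central_binomial (Suc n)"
    using central_binomial_rec[of "n - 1"] by (cases n) auto
qed

section \<open>Paths of length at most two from the diameter\<close>

context wf_digraph
begin

lemma \<mu>_unit_le_two_imp_path:
  assumes "\<mu> (\<lambda>_. 1) u v \<le> 2" and "u \<noteq> v"
  shows "(u, v) \<in> arcs_ends G \<or> (\<exists>w. (u, w) \<in> arcs_ends G \<and> (w, v) \<in> arcs_ends G)"
proof -
  \<comment> \<open>\<open>\<mu>\<close> is an infimum, so a strict bound is needed to obtain a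
    walk; unit costs make cost below 3 mean at most two arcs.\<close>
  have "\<mu> (\<lambda>_. 1) u v < 3" using assms(1) by (rule order.strict_trans1) simp
  then obtain p where p: "awalk u p v" "awalk_cost (\<lambda>_. 1) p < 3"
    unfolding \<mu>_def by (auto simp: INF_less_iff)
  have ends: "(tail G e, head G e) \<in> arcs_ends G" if "e \<in> arcs G" for e
    using that by (auto simp: arcs_ends_def arc_to_ends_def)
  have "awalk_cost (\<lambda>_. 1) p = length p" by (induction p) auto
  then have "length p < 3" using p(2) by simp
  then consider "p = []" | e where "p = [e]" | e f where "p = [e, f]"
    \<comment> \<open>The rule serves only to split lists into length 0, length 1 and length at
      least 2.\<close>
    by (cases p rule: remdups_adj.cases) (auto simp: neq_Nil_conv)
  then show ?thesis
  proof cases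
    case 1 then show ?thesis using p(1) assms(2) by (simp add: awalk_Nil_iff)
  next
    case (2 e) then show ?thesis using p(1) ends by (auto simp: awalk_simps)
  next
    case (3 e f) then show ?thesis using p(1) ends by (auto simp: awalk_simps) metis
  qed
qed

end

lemma (in pair_wf_digraph) diam_le_two_imp_path:
  assumes "diam (with_proj G) \<le> 2" and "u \<in> pverts G" and "v \<in> pverts G" and "u \<noteq> v"
  shows "(u, v) \<in> parcs G \<or> (\<exists>w. (u, w) \<in> parcs G \<and> (w, v) \<in> parcs G)"
proof -
  have "distance (with_proj G) u v \<le> diam (with_proj G)"
    unfolding diam_def using assms(2,3) by (intro SUP_upper2[of "(u, v)"]) auto
  then show ?thesis
    using \<mu>_unit_le_two_imp_path[of u v] assms(1,4) unfolding distance_def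
    by (meson order_trans)
qed

section \<open>Types of the vertices outside the first part\<close>

locale tripartite_diam_two =
  fixes D :: "'a pair_pre_digraph" and x :: "nat \<Rightarrow> 'a" and V2 V3 :: "'a set"
  assumes finite_parts: "finite V2" "finite V3"
    and disjoint_parts: "x ` {1..3} \<inter> V2 = {}" "x ` {1..3} \<inter> V3 = {}" "V2 \<inter> V3 = {}"
    and orientation: "orientation D (complete_tripartite (x ` {1..3}) V2 V3)"
    and two_step: "\<And>u v. u \<in> pverts D \<Longrightarrow> v \<in> pverts D \<Longrightarrow> u \<noteq> v \<Longrightarrow>
      (u, v) \<in> parcs D \<or> (\<exists>w. (u, w) \<in> parcs D \<and> (w, v) \<in> parcs D)"
begin

definition in_type :: "'a \<Rightarrow> nat set" where
  "in_type w = {i \<in> {1..3}. (x i, w) \<in> parcs D}"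

definition type_count :: "nat set \<Rightarrow> nat" where
  "type_count B = card {z \<in> V3. in_type z = B}"

lemma verts: "pverts D = x ` {1..3} \<union> V2 \<union> V3"
  using orientation by (simp add: orientation_def complete_tripartite_def)

lemma arcD:
  assumes "(u, v) \<in> parcs D"
  shows "(u, v) \<in> x ` {1..3} \<times> (V2 \<union> V3) \<union> V2 \<times> (x ` {1..3} \<union> V3) \<union> V3 \<times> (x ` {1..3} \<union> V2)"
  using assms orientation unfolding orientation_def complete_tripartite_def
  by (metis pair_pre_digraph.select_convs(2) subsetD)

lemma arc_flip:
  assumes "(u, v) \<in> x ` {1..3} \<times> (V2 \<union> V3) \<union> V2 \<times> (x ` {1..3} \<union> V3) \<union> V3 \<times> (x ` {1..3} \<union> V2)"
  shows "(v, u) \<in> parcs D \<longleftrightarrow> (u, v) \<notin> parcs D"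
proof -
  have "\<forall>(u, v) \<in> parcs (complete_tripartite (x ` {1..3}) V2 V3).
      (u, v) \<in> parcs D \<longleftrightarrow> (v, u) \<notin> parcs D"
    using orientation by (simp add: orientation_def)
  then show ?thesis using assms unfolding complete_tripartite_def by fastforce
qed

lemma in_type_subset: "in_type w \<subseteq> {1..3}"
  by (auto simp: in_type_def)

lemma nbr_class_iff:
  assumes "w \<in> V2" and "A \<subseteq> {1..3}"
  shows "w \<in> nbr_class D x A \<longleftrightarrow> in_type w = A"
proof -
  have "(w, x i) \<in> parcs D \<longleftrightarrow> (x i, w) \<notin> parcs D" if "i \<in> {1..3}" for i
    using that assms(1) by (intro arc_flip) auto
  then show ?thesis
    using assms by (auto simp: nbr_class_def in_type_def verts)
qed

text \<open>A path of length two closing the arc back has to pass through the first part.\<close>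

lemma arc_imp_not_in_type_subset:
  assumes "(u, v) \<in> parcs D" and "u \<in> V2 \<and> v \<in> V3 \<or> u \<in> V3 \<and> v \<in> V2"
  shows "\<not> in_type u \<subseteq> in_type v"
proof -
  have "(v, u) \<notin> parcs D" using arc_flip[of u v] assms by auto
  moreover have "u \<noteq> v" using assms(2) disjoint_parts by (auto simp: disjoint_iff)
  ultimately obtain w where w: "(v, w) \<in> parcs D" "(w, u) \<in> parcs D"
    using two_step[of v u] assms(2) by (auto simp: verts)
  then have "w \<in> x ` {1..3}"
    using arcD[OF w(1)] arcD[OF w(2)] assms(2) disjoint_parts by (auto simp: disjoint_iff)
  then obtain i where i: "i \<in> {1..3}" "w = x i" by blast
  then have "i \<in> in_type u" using w(2) by (simp add: in_type_def)
  moreover have "i \<notin> in_type v"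
    using w(1) arc_flip[of "x i" v] i assms(2) by (auto simp: in_type_def)
  ultimately show ?thesis by blast
qed

text \<open>By contraposition: comparable types determine the arc, which runs from the larger type
  to the smaller. Equal types would force both directions.\<close>

lemma arc_if_in_type_subset:
  assumes "u \<in> V2 \<and> v \<in> V3 \<or> u \<in> V3 \<and> v \<in> V2" and "in_type u \<subseteq> in_type v"
  shows "(v, u) \<in> parcs D"
  using arc_imp_not_in_type_subset[of u v] arc_flip[of u v] assms by auto

lemma in_type_neq:
  assumes "y \<in> V2" and "z \<in> V3"
  shows "in_type y \<noteq> in_type z"
  using arc_if_in_type_subset[of y z] arc_imp_not_in_type_subset[of z y] assms by auto

text \<open>Since \<open>x i\<close> dominates \<open>y\<close>, the way back has length two, and a
  common neighbour of \<open>y\<close> and \<open>x i\<close> lies in \<open>V3\<close>.\<close>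

lemma ex_not_in_type:
  assumes "y \<in> V2" and "i \<in> in_type y"
  shows "\<exists>z\<in>V3. i \<notin> in_type z"
proof -
  have i: "i \<in> {1..3}" "(x i, y) \<in> parcs D" using assms(2) by (auto simp: in_type_def)
  then have "(y, x i) \<notin> parcs D" using arc_flip[of "x i" y] assms(1) by auto
  moreover have "y \<noteq> x i" using i(1) assms(1) disjoint_parts by (auto simp: disjoint_iff)
  ultimately obtain w where w: "(y, w) \<in> parcs D" "(w, x i) \<in> parcs D"
    using two_step[of y "x i"] assms(1) i(1) by (auto simp: verts)
  have "w \<in> V3"
    using arcD[OF w(1)] arcD[OF w(2)] assms(1) i(1) disjoint_parts by (auto simp: disjoint_iff)
  moreover have "i \<notin> in_type w"
    using w(2) arc_flip[of "x i" w] i(1) calculation by (auto simp: in_type_def)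
  ultimately show ?thesis by blast
qed

text \<open>The dual argument, with the path from \<open>x i\<close> to \<open>y\<close>.\<close>

lemma ex_in_type:
  assumes "y \<in> V2" and "i \<in> {1..3}" and "i \<notin> in_type y"
  shows "\<exists>z\<in>V3. i \<in> in_type z"
proof -
  have "(x i, y) \<notin> parcs D" using assms(2,3) by (auto simp: in_type_def)
  moreover have "x i \<noteq> y" using assms(1,2) disjoint_parts by (auto simp: disjoint_iff)
  ultimately obtain w where w: "(x i, w) \<in> parcs D" "(w, y) \<in> parcs D"
    using two_step[of "x i" y] assms(1,2) by (auto simp: verts)
  have "w \<in> V3"
    using arcD[OF w(1)] arcD[OF w(2)] assms(1,2) disjoint_parts by (auto simp: disjoint_iff)
  moreover have "i \<in> in_type w"
    using w(1) assms(2) by (auto simp: in_type_def)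
  ultimately show ?thesis by blast
qed

text \<open>Vertices of \<open>V3\<close> of the same type agree on their arcs to and from all vertices of \<open>V2\<close> of
  comparable type, so their out-neighbourhoods among the remaining vertices form an antichain.\<close>

lemma type_count_le_central_binomial:
  "type_count B \<le>
    central_binomial (card {y \<in> V2. \<not> in_type y \<subseteq> B \<and> \<not> B \<subseteq> in_type y})"
proof -
  define S where "S = {y \<in> V2. \<not> in_type y \<subseteq> B \<and> \<not> B \<subseteq> in_type y}"
  define R where "R z = {y \<in> S. (z, y) \<in> parcs D}" for z
  \<comment> \<open>A path from \<open>z\<close> to \<open>z'\<close> through \<open>V1\<close>
    would make their types differ. So its middle vertex \<open>w\<close> is in \<open>V2\<close>,
    both arcs make the type of \<open>w\<close> incomparable to \<open>B\<close>, and
    \<open>w\<close> lies in \<open>R z\<close> but not in \<open>R z'\<close>.\<close>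
  have antichain: "z = z'"
    if z: "z \<in> V3" "in_type z = B" and z': "z' \<in> V3" "in_type z' = B" and sub: "R z \<subseteq> R z'" for z z'
  proof (rule ccontr)
    assume "z \<noteq> z'"
    moreover have "(z, z') \<notin> parcs D"
      using arcD[of z z'] z(1) z'(1) disjoint_parts by (auto simp: disjoint_iff)
    ultimately obtain w where w: "(z, w) \<in> parcs D" "(w, z') \<in> parcs D"
      using two_step[of z z'] z(1) z'(1) by (auto simp: verts)
    have "w \<notin> V3" using arcD[OF w(1)] z(1) disjoint_parts by (auto simp: disjoint_iff)
    moreover have "w \<notin> x ` {1..3}"
    proof
      assume "w \<in> x ` {1..3}"
      then obtain i where i: "i \<in> {1..3}" "w = x i" by blast
      have "i \<in> in_type z'" using i w(2) by (simp add: in_type_def)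
      moreover have "i \<notin> in_type z"
        using w(1) arc_flip[of "x i" z] i z(1) by (auto simp: in_type_def)
      ultimately show False using z(2) z'(2) by blast
    qed
    ultimately have V2: "w \<in> V2" using arcD[OF w(1)] by auto
    have "\<not> B \<subseteq> in_type w" using arc_imp_not_in_type_subset[OF w(1)] z V2 by blast
    moreover have "\<not> in_type w \<subseteq> B" using arc_imp_not_in_type_subset[OF w(2)] z' V2 by blast
    ultimately have "w \<in> R z" using V2 w(1) by (simp add: R_def S_def)
    then have "(z', w) \<in> parcs D" using sub by (auto simp: R_def)
    then show False using w(2) arc_flip[of w z'] V2 z'(1) by auto
  qed
  have "inj_on R {z \<in> V3. in_type z = B}"
    by (rule inj_onI) (use antichain in auto)
  then have "type_count B = card (R ` {z \<in> V3. in_type z = B})"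
    by (simp add: type_count_def card_image)
  also have "\<dots> \<le> central_binomial (card S)"
  proof (rule sperner)
    show "finite S" using finite_parts by (simp add: S_def)
    show "R ` {z \<in> V3. in_type z = B} \<subseteq> Pow S" by (auto simp: R_def)
  qed (use antichain in auto)
  finally show ?thesis by (simp add: S_def)
qed

text \<open>Each occurring type comparable to \<open>B\<close> uses up at least one vertex of
  \<open>V2\<close>.\<close>

lemma card_incomparable_le:
  "card {y \<in> V2. \<not> in_type y \<subseteq> B \<and> \<not> B \<subseteq> in_type y}
    \<le> card V2 - card {A \<in> in_type ` V2. A \<subseteq> B \<or> B \<subseteq> A}"
proof -
  let ?C = "{y \<in> V2. in_type y \<subseteq> B \<or> B \<subseteq> in_type y}"
  have "{A \<in> in_type ` V2. A \<subseteq> B \<or> B \<subseteq> A} = in_type ` ?C" by auto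
  then have "card {A \<in> in_type ` V2. A \<subseteq> B \<or> B \<subseteq> A} \<le> card ?C"
    using finite_parts by (simp add: card_image_le)
  moreover have "{y \<in> V2. \<not> in_type y \<subseteq> B \<and> \<not> B \<subseteq> in_type y} = V2 - ?C" by auto
  then have "card {y \<in> V2. \<not> in_type y \<subseteq> B \<and> \<not> B \<subseteq> in_type y} = card V2 - card ?C"
    using finite_parts by (simp add: card_Diff_subset)
  ultimately show ?thesis by simp
qed

lemma card_V3_eq_sum: "card V3 = (\<Sum>B\<in>Pow {1..3}. type_count B)"
proof -
  have "card V3 = (\<Sum>B\<in>Pow {1..3}. \<Sum>z | z \<in> V3 \<and> in_type z = B. 1)"
    using finite_parts in_type_subset by (subst sum.group) auto
  then show ?thesis by (simp add: type_count_def)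
qed

lemma type_count_eq_0:
  assumes "B \<in> in_type ` V2" shows "type_count B = 0"
  using assms in_type_neq finite_parts by (force simp: type_count_def)

lemma type_count_pos: "z \<in> V3 \<Longrightarrow> type_count (in_type z) > 0"
  using finite_parts by (auto simp: type_count_def card_gt_0_iff)

end

section \<open>The arithmetic of five occurring types\<close>

lemma Pow_123: "Pow {1..3::nat} = {{}, {1}, {2}, {3}, {1, 2}, {1, 3}, {2, 3}, {1, 2, 3}}"
  and atLeastAtMost_1_3: "{1..3::nat} = {1, 2, 3}"
proof -
  show *: "{1..3::nat} = {1, 2, 3}" by auto
  show "Pow {1..3::nat} = {{}, {1}, {2}, {3}, {1, 2}, {1, 3}, {2, 3}, {1, 2, 3}}"
    unfolding * by (simp add: Pow_insert insert_commute)
qed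

lemma sum_Pow_123:
  "(\<Sum>B\<in>Pow {1..3::nat}. f B) =
    f {} + f {1} + f {2} + f {3} + f {1, 2} + f {1, 3} + f {2, 3} + f {1, 2, 3}"
  unfolding Pow_123
  by (auto simp: insert_eq_iff doubleton_eq_iff add_ac)

text \<open>Here \<open>t123\<close> says whether the type \<open>{1, 2, 3}\<close> occurs in \<open>V2\<close>, \<open>b123\<close> counts the vertices of
  that type in \<open>V3\<close>, and so on; \<open>f k\<close> stands for \<open>central_binomial (p - k)\<close>.\<close>

lemma five_types_arith:
  fixes t0 t1 t2 t3 t12 t13 t23 t123 :: bool
    and b0 b1 b2 b3 b12 b13 b23 b123 :: nat and f :: "nat \<Rightarrow> nat"
  assumes "of_bool t0 + of_bool t1 + of_bool t2 + of_bool t3 +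
      of_bool t12 + of_bool t13 + of_bool t23 + of_bool t123 = (5::nat)"
    and "t0 \<Longrightarrow> b0 = 0" "t1 \<Longrightarrow> b1 = 0" "t2 \<Longrightarrow> b2 = 0" "t3 \<Longrightarrow> b3 = 0"
      "t12 \<Longrightarrow> b12 = 0" "t13 \<Longrightarrow> b13 = 0" "t23 \<Longrightarrow> b23 = 0" "t123 \<Longrightarrow> b123 = 0"
    and "b0 \<le> 1" "b123 \<le> 1"
    and "b1 \<le> f (of_bool t0 + of_bool t1 + of_bool t12 + of_bool t13 + of_bool t123)"
      "b2 \<le> f (of_bool t0 + of_bool t2 + of_bool t12 + of_bool t23 + of_bool t123)"
      "b3 \<le> f (of_bool t0 + of_bool t3 + of_bool t13 + of_bool t23 + of_bool t123)"
      "b12 \<le> f (of_bool t0 + of_bool t1 + of_bool t2 + of_bool t12 + of_bool t123)"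
      "b13 \<le> f (of_bool t0 + of_bool t1 + of_bool t3 + of_bool t13 + of_bool t123)"
      "b23 \<le> f (of_bool t0 + of_bool t2 + of_bool t3 + of_bool t23 + of_bool t123)"
    and "b1 + b12 + b13 + b123 \<ge> 1" "b2 + b12 + b23 + b123 \<ge> 1"
      "b3 + b13 + b23 + b123 \<ge> 1"
      "b0 + b2 + b3 + b23 \<ge> 1" "b0 + b1 + b3 + b13 \<ge> 1" "b0 + b1 + b2 + b12 \<ge> 1"
    and "f 4 \<le> f 3" "f 3 + f 4 \<le> f 2" "2 \<le> f 3" "1 \<le> f 4"
  shows "b0 + b1 + b2 + b3 + b12 + b13 + b23 + b123 \<le> f 3 + f 2"
  \<comment> \<open>Only \<open>assms(1)\<close> at first: \<open>simp\<close> diverges on the other facts if there are few types.\<close>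
  by (insert assms(1), cases t0; cases t1; cases t2; cases t3; cases t12; cases t13; cases t23;
      cases t123; (simp; fail)?)
    (use assms(2-) in \<open>simp del: One_nat_def; linarith\<close>)+

text \<open>The sum of indicators unfolds into the \<open>of_bool\<close> terms of
  \<open>five_types_arith\<close>.\<close>

lemma card_comparable:
  assumes "T \<subseteq> Pow {1..3::nat}"
  shows "card {A \<in> T. A \<subseteq> B \<or> B \<subseteq> A} = (\<Sum>A\<in>Pow {1..3}. of_bool (A \<in> T \<and> (A \<subseteq> B \<or> B \<subseteq> A)))"
proof -
  have "{A \<in> T. A \<subseteq> B \<or> B \<subseteq> A} = Pow {1..3} \<inter> {A. A \<in> T \<and> (A \<subseteq> B \<or> B \<subseteq> A)}"
    using assms by blast
  then show ?thesis by (simp add: sum_of_bool_eq)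
qed

text \<open>The graph is abstracted away: \<open>T\<close> stands for the types occurring in
  \<open>V2\<close>, \<open>b\<close> for the type counts in \<open>V3\<close>, and \<open>m\<close>
  for \<open>p\<close>.\<close>

lemma five_types_sum_le:
  fixes T :: "nat set set" and b :: "nat set \<Rightarrow> nat" and m :: nat
  assumes T: "T \<subseteq> Pow {1..3}" "card T = 5" and m: "m \<ge> 5"
    and zero: "\<And>B. B \<in> T \<Longrightarrow> b B = 0"
    and ends: "b {} \<le> 1" "b {1..3} \<le> 1"
    and bound: "\<And>B. b B \<le> central_binomial (m - card {A \<in> T. A \<subseteq> B \<or> B \<subseteq> A})"
    and avoid: "\<And>A i. A \<in> T \<Longrightarrow> i \<in> A \<Longrightarrow> \<exists>B. B \<subseteq> {1..3} \<and> i \<notin> B \<and> b B > 0"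
    and hit: "\<And>A i. A \<in> T \<Longrightarrow> i \<in> {1..3} - A \<Longrightarrow> \<exists>B. B \<subseteq> {1..3} \<and> i \<in> B \<and> b B > 0"
  shows "(\<Sum>B\<in>Pow {1..3}. b B) \<le> central_binomial (m - 3) + central_binomial (m - 2)"
proof -
  define f where "f k = central_binomial (m - k)" for k
  \<comment> \<open>A type outside \<open>T\<close> other than \<open>{}\<close> and
    \<open>{1..3}\<close> is incomparable to three types and comparable to four others, so 2 to 4
    members of \<open>T\<close> are comparable to it. The second inequality is for three such types;
    \<open>2 \<le> f 3\<close>, from \<open>m \<ge> 5\<close>, absorbs the vertices of types
    \<open>{}\<close> and \<open>{1..3}\<close>.\<close>
  have f_ineq: "f 4 \<le> f 3" "f 3 + f 4 \<le> f 2" "2 \<le> f 3" "1 \<le> f 4"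
  proof -
    show "f 4 \<le> f 3" unfolding f_def by (rule central_binomial_mono) simp
    have "m - 4 + 1 = m - 3" "m - 4 + 2 = m - 2" using m by auto
    then show "f 3 + f 4 \<le> f 2" using central_binomial_rec[of "m - 4"] unfolding f_def by metis
    show "2 \<le> f 3" using central_binomial_mono[of 2 "m - 3"] m unfolding f_def by simp
    show "1 \<le> f 4" unfolding f_def by (simp add: Suc_le_eq)
  qed
  \<comment> \<open>Everything is comparable to \<open>{}\<close>, so \<open>card_comparable\<close>
    counts all of \<open>T\<close>.\<close>
  have five: "(\<Sum>A\<in>Pow {1..3}. of_bool (A \<in> T)) = (5::nat)"
    using card_comparable[OF T(1), of "{}"] T(2) by simp
  have bound_f: "b B \<le> f (\<Sum>A\<in>Pow {1..3}. of_bool (A \<in> T \<and> (A \<subseteq> B \<or> B \<subseteq> A)))" for B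
    using bound[of B] unfolding f_def card_comparable[OF T(1)] .
  \<comment> \<open>Four subsets of \<open>{1..3}\<close> contain \<open>i\<close> and four avoid
    it, so five types include both kinds; thus \<open>avoid\<close> and \<open>hit\<close> apply to
    every \<open>i\<close>.\<close>
  have mixed: "(\<exists>A\<in>T. i \<in> A) \<and> (\<exists>A\<in>T. i \<notin> A)" if i: "i \<in> {1..3}" for i
  proof -
    let ?P = "Pow ({1..3} - {i})"
    have "card ?P = 4" using i by (simp add: card_Pow)
    moreover have "card (insert i ` ?P) \<le> card ?P" by (rule card_image_le) simp
    ultimately have "\<not> T \<subseteq> ?P" "\<not> T \<subseteq> insert i ` ?P"
      using T(2) card_mono[of ?P T] card_mono[of "insert i ` ?P" T] by auto
    moreover have "A \<in> insert i ` ?P" if "A \<in> T" "i \<in> A" for A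
      using that T(1) by (intro image_eqI[of _ _ "A - {i}"]) auto
    ultimately show ?thesis using T(1) by blast
  qed
  have avoid_sum: "(\<Sum>B\<in>Pow {1..3}. b B * of_bool (i \<notin> B)) \<ge> 1" if i: "i \<in> {1..3}" for i
  proof -
    obtain B where "B \<in> Pow {1..3}" "i \<notin> B" "b B > 0" using avoid mixed[OF i] by blast
    then show ?thesis
      using member_le_sum[of B "Pow {1..3}" "\<lambda>B. b B * of_bool (i \<notin> B)"] by simp
  qed
  have hit_sum: "(\<Sum>B\<in>Pow {1..3}. b B * of_bool (i \<in> B)) \<ge> 1" if i: "i \<in> {1..3}" for i
  proof -
    obtain B where "B \<in> Pow {1..3}" "i \<in> B" "b B > 0" using hit mixed[OF i] i by blast
    then show ?thesis
      using member_le_sum[of B "Pow {1..3}" "\<lambda>B. b B * of_bool (i \<in> B)"] by simp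
  qed
  have "b {} + b {1} + b {2} + b {3} + b {1, 2} + b {1, 3} + b {2, 3} + b {1, 2, 3} \<le> f 3 + f 2"
  proof (rule five_types_arith)
    show "of_bool ({} \<in> T) + of_bool ({1} \<in> T) + of_bool ({2} \<in> T) + of_bool ({3} \<in> T) +
      of_bool ({1, 2} \<in> T) + of_bool ({1, 3} \<in> T) + of_bool ({2, 3} \<in> T) +
      of_bool ({1, 2, 3} \<in> T) = (5::nat)"
      using five unfolding sum_Pow_123 .
    show "b {} \<le> 1" "b {1, 2, 3} \<le> 1" using ends unfolding atLeastAtMost_1_3 by simp_all
    show "b {1} \<le> f (of_bool ({} \<in> T) + of_bool ({1} \<in> T) +
          of_bool ({1, 2} \<in> T) + of_bool ({1, 3} \<in> T) + of_bool ({1, 2, 3} \<in> T))"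
      "b {2} \<le> f (of_bool ({} \<in> T) + of_bool ({2} \<in> T) + of_bool ({1, 2} \<in> T) +
          of_bool ({2, 3} \<in> T) + of_bool ({1, 2, 3} \<in> T))"
      "b {3} \<le> f (of_bool ({} \<in> T) + of_bool ({3} \<in> T) + of_bool ({1, 3} \<in> T) +
          of_bool ({2, 3} \<in> T) + of_bool ({1, 2, 3} \<in> T))"
      "b {1, 2} \<le> f (of_bool ({} \<in> T) + of_bool ({1} \<in> T) + of_bool ({2} \<in> T) +
          of_bool ({1, 2} \<in> T) + of_bool ({1, 2, 3} \<in> T))"
      "b {1, 3} \<le> f (of_bool ({} \<in> T) + of_bool ({1} \<in> T) + of_bool ({3} \<in> T) +
          of_bool ({1, 3} \<in> T) + of_bool ({1, 2, 3} \<in> T))"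
      "b {2, 3} \<le> f (of_bool ({} \<in> T) + of_bool ({2} \<in> T) + of_bool ({3} \<in> T) +
          of_bool ({2, 3} \<in> T) + of_bool ({1, 2, 3} \<in> T))"
      using bound_f[of "{1}"] bound_f[of "{2}"] bound_f[of "{3}"] bound_f[of "{1, 2}"]
        bound_f[of "{1, 3}"] bound_f[of "{2, 3}"]
      unfolding sum_Pow_123 by (simp_all add: doubleton_eq_iff insert_eq_iff)
    show "b {1} + b {1, 2} + b {1, 3} + b {1, 2, 3} \<ge> 1"
      "b {2} + b {1, 2} + b {2, 3} + b {1, 2, 3} \<ge> 1"
      "b {3} + b {1, 3} + b {2, 3} + b {1, 2, 3} \<ge> 1"
      "b {} + b {2} + b {3} + b {2, 3} \<ge> 1"
      "b {} + b {1} + b {3} + b {1, 3} \<ge> 1"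
      "b {} + b {1} + b {2} + b {1, 2} \<ge> 1"
      using hit_sum[of 1] hit_sum[of 2] hit_sum[of 3] avoid_sum[of 1] avoid_sum[of 2] avoid_sum[of 3]
      unfolding sum_Pow_123 by simp_all
  qed (simp_all only: zero f_ineq)
  then show ?thesis unfolding sum_Pow_123 f_def .
qed

theorem theorem4p20:
  fixes D :: "'a pair_pre_digraph" and x :: "nat \<Rightarrow> 'a" and V1 V2 V3 :: "'a set" and p q :: nat
  assumes "5 \<le> p" and "p \<le> q"
    and "inj_on x {1..3}" and "V1 = x ` {1..3}"
    and "finite V2" and "card V2 = p"
    and "finite V3" and "card V3 = q"
    and "V1 \<inter> V2 = {}" and "V1 \<inter> V3 = {}" and "V2 \<inter> V3 = {}"
    and "strong_orientation D (complete_tripartite V1 V2 V3)"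
    and "diam (with_proj D) = 2"
    and "card {A. A \<subseteq> {1..3} \<and> V2 \<inter> nbr_class D x A \<noteq> {}} = 5"
  shows "q \<le> ((p - 3) choose ((p - 3) div 2)) + ((p - 2) choose ((p - 2) div 2))"
proof -
  have orient: "orientation D (complete_tripartite (x ` {1..3}) V2 V3)"
    using assms(4,12) by (simp add: strong_orientation_def)
  interpret wf: pair_wf_digraph D
    using orient unfolding orientation_def complete_tripartite_def by unfold_locales auto
  interpret tripartite_diam_two D x V2 V3
    using assms orient wf.diam_le_two_imp_path by unfold_locales auto
  have "{A. A \<subseteq> {1..3} \<and> V2 \<inter> nbr_class D x A \<noteq> {}} = in_type ` V2"
    using nbr_class_iff in_type_subset by blast
  then have five: "card (in_type ` V2) = 5" using assms(14) by simp
  \<comment> \<open>Used for \<open>{}\<close> and \<open>{1..3}\<close>, which are comparable to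
    every type: Sperner's bound on the empty set is 1.\<close>
  have trivial: "type_count B \<le> 1"
    if "{y \<in> V2. \<not> in_type y \<subseteq> B \<and> \<not> B \<subseteq> in_type y} = {}" for B
    using type_count_le_central_binomial[of B] unfolding that by simp
  have "card V3 = (\<Sum>B\<in>Pow {1..3}. type_count B)" by (rule card_V3_eq_sum)
  also have "\<dots> \<le> central_binomial (p - 3) + central_binomial (p - 2)"
  proof (rule five_types_sum_le)
    show "in_type ` V2 \<subseteq> Pow {1..3}" using in_type_subset by blast
    show "type_count {} \<le> 1" by (rule trivial) auto
    show "type_count {1..3} \<le> 1" by (rule trivial) (use in_type_subset in blast)
    show "type_count B \<le> central_binomial (p - card {A \<in> in_type ` V2. A \<subseteq> B \<or> B \<subseteq> A})" for B
      using type_count_le_central_binomial[of B] central_binomial_mono[OF card_incomparable_le[of B]]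
        assms(6) by simp
    show "\<exists>B. B \<subseteq> {1..3} \<and> i \<notin> B \<and> type_count B > 0"
      if A: "A \<in> in_type ` V2" "i \<in> A" for A i
    proof -
      obtain z where "z \<in> V3" "i \<notin> in_type z" using A ex_not_in_type by blast
      then show ?thesis using in_type_subset[of z] type_count_pos by blast
    qed
    show "\<exists>B. B \<subseteq> {1..3} \<and> i \<in> B \<and> type_count B > 0"
      if A: "A \<in> in_type ` V2" "i \<in> {1..3} - A" for A i
    proof -
      obtain z where "z \<in> V3" "i \<in> in_type z" using A ex_in_type by blast
      then show ?thesis using in_type_subset[of z] type_count_pos by blast
    qed
  qed (fact assms(1) five | rule type_count_eq_0, assumption)+
  finally show ?thesis using assms(8) by simp
qed

end
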